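(* Let $\ell\ge 5$ and let $\vec C$ be an orientation of the cycle $C_\ell$. If $G$ is a graph with $m(G)<m_2(C_\ell)$, then $G\not\to\vec C$, i.e., $G$ has an orientation containing no copy of $\vec C$.
   Context: $m(G)=\max\{e(J)/v(J):J\subseteq G,\ v(J)\ge1\}$ and $m_2(G)=\max\{(e(J)-1)/(v(J)-2):J\subseteq G,\ v(J)\ge3\}$; in particular $m_2(C_\ell)=(\ell-1)/(\ell-2)$. *)

theory Defs
  imports Complex_Main
begin

type_synonym 'a graph = "'a set \<times> 'a set set"
type_synonym 'a digraph = "'a set \<times> ('a \<times> 'a) set"

abbreviation verts :: "'a graph \<Rightarrow> 'a set" where "verts G \<equiv> fst G"
abbreviation edges :: "'a graph \<Rightarrow> 'a set set" where "edges G \<equiv> snd G"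
abbreviation dverts :: "'a digraph \<Rightarrow> 'a set" where "dverts D \<equiv> fst D"
abbreviation arcs :: "'a digraph \<Rightarrow> ('a \<times> 'a) set" where "arcs D \<equiv> snd D"

definition simple_graph :: "'a graph \<Rightarrow> bool" where
  "simple_graph G \<longleftrightarrow> finite (verts G) \<and> (\<forall>e\<in>edges G. e \<subseteq> verts G \<and> card e = 2)"

definition subgraph :: "'a graph \<Rightarrow> 'a graph \<Rightarrow> bool" where
  "subgraph J G \<longleftrightarrow> simple_graph J \<and> verts J \<subseteq> verts G \<and> edges J \<subseteq> edges G"

text \<open>The value is unspecified when \<open>G\<close> has no vertices.\<close>

definition max_density :: "'a graph \<Rightarrow> real" where
  "max_density G =
     Max {real (card (edges J)) / real (card (verts J)) | J.
            subgraph J G \<and> card (verts J) \<ge> 1}"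

text \<open>The value is unspecified when \<open>G\<close> has fewer than three vertices.\<close>

definition max_2_density :: "'a graph \<Rightarrow> real" where
  "max_2_density G =
     Max {(real (card (edges J)) - 1) / (real (card (verts J)) - 2) | J.
            subgraph J G \<and> card (verts J) \<ge> 3}"

text \<open>This is the cycle of length \<open>l\<close> only for \<open>l \<ge> 3\<close>.\<close>

definition cycle_graph :: "nat \<Rightarrow> nat graph" where
  "cycle_graph l = ({..<l}, {{i, (i + 1) mod l} | i. i < l})"

definition orientation_of :: "'a digraph \<Rightarrow> 'a graph \<Rightarrow> bool" where
  "orientation_of D G \<longleftrightarrow>
     dverts D = verts G \<and>
     (\<forall>u v. (u, v) \<in> arcs D \<longrightarrow> {u, v} \<in> edges G) \<and>
     (\<forall>u v. {u, v} \<in> edges G \<longrightarrow> ((u, v) \<in> arcs D \<longleftrightarrow> (v, u) \<notin> arcs D))"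

text \<open>Copies are not required to be induced.\<close>

definition contains_copy :: "'a digraph \<Rightarrow> 'b digraph \<Rightarrow> bool" where
  "contains_copy D H \<longleftrightarrow>
     (\<exists>f. inj_on f (dverts H) \<and> f ` dverts H \<subseteq> dverts D \<and>
          (\<forall>(u, v)\<in>arcs H. (f u, f v) \<in> arcs D))"

text \<open>The relation \<open>G \<rightarrow> H\<close>.\<close>

definition arrows :: "'a graph \<Rightarrow> 'b digraph \<Rightarrow> bool" where
  "arrows G H \<longleftrightarrow> (\<forall>D. orientation_of D G \<longrightarrow> contains_copy D H)"

end

theory Submission
  imports Defs
begin

text \<open>Unrolling a copy of \<open>C\<close> gives a two-way infinite walk that never turns back, and it is enough to
  orient \<open>G\<close> so that no such walk follows the orientation pattern of \<open>C\<close>. The density bound makes \<open>G\<close>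
  2-degenerate, hence 3-colourable. Orienting every edge towards the larger colour leaves no directed
  path with three edges, which settles every \<open>C\<close> containing such a path.

  Otherwise delete a small configuration from \<open>G\<close>, orient the rest by induction, and extend so that no
  walk meets the configuration. A vertex of degree at most one lies on no walk. A vertex of degree two
  that is oriented as inner vertex of a directed path is passed along its direction, so two adjacent
  such vertices would produce a directed path with three edges. Discharging finds one of these two
  configurations when \<open>l \<ge> 7\<close>. For \<open>l \<le> 6\<close> there may instead be a tee: a vertex \<open>x\<close> of degree
  three with neighbours \<open>y1\<close>, \<open>y2\<close> of degree two and \<open>w\<close>. With \<open>y1 \<rightarrow> x\<close>, \<open>y2 \<rightarrow> x\<close>, \<open>x \<rightarrow> w\<close> and the
  other edges at \<open>y1\<close>, \<open>y2\<close> directed towards these, a walk can only pass \<open>x\<close> where two directed paths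
  with two edges meet head to head. With all arcs reversed they meet tail to tail, and a cycle of
  length five or six cannot have both.\<close>

section \<open>Degrees in simple graphs\<close>

definition neighbours :: "'a graph \<Rightarrow> 'a \<Rightarrow> 'a set" where
  "neighbours G v = {u. {u, v} \<in> edges G}"

definition degree :: "'a graph \<Rightarrow> 'a \<Rightarrow> nat" where
  "degree G v = card (neighbours G v)"

definition degree_two_neighbours :: "'a graph \<Rightarrow> 'a \<Rightarrow> 'a set" where
  "degree_two_neighbours G v = {u \<in> neighbours G v. degree G u = 2}"

definition delete_verts :: "'a graph \<Rightarrow> 'a set \<Rightarrow> 'a graph" where
  "delete_verts G X = (verts G - X, {e \<in> edges G. e \<inter> X = {}})"

lemma simple_graph_finite_verts: "simple_graph G \<Longrightarrow> finite (verts G)"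
  by (simp add: simple_graph_def)

lemma simple_graph_finite_edges: "simple_graph G \<Longrightarrow> finite (edges G)"
  by (rule finite_subset[of _ "Pow (verts G)"]) (auto simp: simple_graph_def)

lemma edge_ends_distinct: "simple_graph G \<Longrightarrow> {u, v} \<in> edges G \<Longrightarrow> u \<noteq> v"
  by (force simp: simple_graph_def)

lemma neighbours_sym: "u \<in> neighbours G v \<longleftrightarrow> v \<in> neighbours G u"
  by (simp add: neighbours_def insert_commute)

lemma neighbours_subset_verts: "simple_graph G \<Longrightarrow> neighbours G v \<subseteq> verts G"
  by (force simp: neighbours_def simple_graph_def)

lemma finite_neighbours: "simple_graph G \<Longrightarrow> finite (neighbours G v)"
  using neighbours_subset_verts simple_graph_finite_verts finite_subset by metis

lemma degree_eq_card_incident: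
  assumes "simple_graph G"
  shows "degree G v = card {e \<in> edges G. v \<in> e}"
  unfolding degree_def
proof (rule bij_betw_same_card[of "\<lambda>u. {u, v}"], rule bij_betwI')
  fix x y
  show "({x, v} = {y, v}) = (x = y)" by (auto simp: doubleton_eq_iff)
next
  fix x assume "x \<in> neighbours G v"
  then show "{x, v} \<in> {e \<in> edges G. v \<in> e}" by (simp add: neighbours_def)
next
  fix e assume e: "e \<in> {e \<in> edges G. v \<in> e}"
  then have "card e = 2" using assms by (auto simp: simple_graph_def)
  with e obtain x where "e = {x, v}" by (auto simp: card_2_iff)
  then show "\<exists>x\<in>neighbours G v. e = {x, v}" using e by (auto simp: neighbours_def)
qed

lemma sum_degree:
  assumes "simple_graph G"
  shows "(\<Sum>v\<in>verts G. degree G v) = 2 * card (edges G)"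
proof -
  have "(\<Sum>v\<in>verts G. degree G v) = (\<Sum>v\<in>verts G. \<Sum>e | e \<in> edges G \<and> v \<in> e. 1)"
    by (simp add: degree_eq_card_incident[OF assms])
  also have "\<dots> = (\<Sum>e\<in>edges G. \<Sum>v | v \<in> verts G \<and> v \<in> e. 1)"
    using simple_graph_finite_verts[OF assms] simple_graph_finite_edges[OF assms]
    by (rule sum.swap_restrict)
  also have "\<dots> = (\<Sum>e\<in>edges G. 2)"
  proof (rule sum.cong)
    fix e assume "e \<in> edges G"
    then have "e \<subseteq> verts G" "card e = 2" using assms by (auto simp: simple_graph_def)
    moreover from this have "{v. v \<in> verts G \<and> v \<in> e} = e" by auto
    ultimately show "(\<Sum>v | v \<in> verts G \<and> v \<in> e. 1) = (2::nat)" by simp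
  qed simp
  finally show ?thesis by simp
qed

lemma exists_degree_le:
  assumes "simple_graph G" "2 * card (edges G) < (d + 1) * card (verts G)"
  shows "\<exists>v\<in>verts G. degree G v \<le> d"
proof (rule ccontr)
  assume "\<not> ?thesis"
  then have "(\<Sum>v\<in>verts G. d + 1) \<le> (\<Sum>v\<in>verts G. degree G v)"
    by (intro sum_mono) (simp add: not_le Suc_le_eq)
  then show False using assms by (simp add: sum_degree mult.commute)
qed

lemma sum_card_neighbours_Int_swap:
  assumes "finite S" "finite T"
  shows "(\<Sum>v\<in>S. card (neighbours G v \<inter> T)) = (\<Sum>u\<in>T. card (neighbours G u \<inter> S))"
proof -
  have card_eq: "card (neighbours G v \<inter> R) = (\<Sum>u | u \<in> R \<and> u \<in> neighbours G v. 1)" for v R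
    by (simp add: Int_def conj_commute)
  show ?thesis
    unfolding card_eq sum.swap_restrict[OF assms] by (simp add: neighbours_sym)
qed

lemma subgraph_refl: "simple_graph G \<Longrightarrow> subgraph G G"
  by (simp add: subgraph_def)

lemma subgraph_trans: "subgraph J H \<Longrightarrow> subgraph H G \<Longrightarrow> subgraph J G"
  by (auto simp: subgraph_def)

lemma simple_graph_delete_verts: "simple_graph G \<Longrightarrow> simple_graph (delete_verts G X)"
  by (auto simp: simple_graph_def delete_verts_def)

lemma subgraph_delete_verts: "simple_graph G \<Longrightarrow> subgraph (delete_verts G X) G"
  using simple_graph_delete_verts[of G X] by (auto simp: subgraph_def delete_verts_def)

lemma delete_verts_induct [consumes 1, case_names empty delete]:
  assumes "simple_graph G"
    and "P ({}, {})"
    and "\<And>G. simple_graph G \<Longrightarrow> verts G \<noteq> {} \<Longrightarrow>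
      (\<And>X. X \<inter> verts G \<noteq> {} \<Longrightarrow> P (delete_verts G X)) \<Longrightarrow> P G"
  shows "P G"
  using assms(1)
proof (induction "card (verts G)" arbitrary: G rule: less_induct)
  case less
  show ?case
  proof (cases "verts G = {}")
    case True
    then have "edges G = {}" using less.prems by (force simp: simple_graph_def)
    with True have "G = ({}, {})" by (simp add: prod_eq_iff)
    then show ?thesis using assms(2) by simp
  next
    case False
    have "P (delete_verts G X)" if "X \<inter> verts G \<noteq> {}" for X
    proof (rule less.hyps[OF _ simple_graph_delete_verts[OF less.prems]])
      show "card (verts (delete_verts G X)) < card (verts G)"
        using that simple_graph_finite_verts[OF less.prems]
        by (intro psubset_card_mono) (auto simp: delete_verts_def)
    qed
    then show ?thesis using assms(3) less.prems False by blast
  qed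
qed

section \<open>Colouring degenerate graphs\<close>

definition degenerate :: "nat \<Rightarrow> 'a graph \<Rightarrow> bool" where
  "degenerate d G \<longleftrightarrow> (\<forall>J. subgraph J G \<longrightarrow> verts J \<noteq> {} \<longrightarrow> (\<exists>v\<in>verts J. degree J v \<le> d))"

definition proper_colouring :: "('a \<Rightarrow> 'b) \<Rightarrow> 'a graph \<Rightarrow> bool" where
  "proper_colouring c G \<longleftrightarrow> (\<forall>u v. {u, v} \<in> edges G \<longrightarrow> c u \<noteq> c v)"

lemma degenerate_subgraph: "degenerate d G \<Longrightarrow> subgraph H G \<Longrightarrow> degenerate d H"
  unfolding degenerate_def using subgraph_trans by blast

lemma proper_colouring_extend:
  assumes "simple_graph G" "proper_colouring c (delete_verts G {v})" "a \<notin> c ` neighbours G v"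
  shows "proper_colouring (c(v := a)) G"
  unfolding proper_colouring_def
proof (intro allI impI)
  fix x y assume xy: "{x, y} \<in> edges G"
  then have "x \<noteq> y" by (rule edge_ends_distinct[OF assms(1)])
  then consider "x = v" "y \<in> neighbours G v" | "y = v" "x \<in> neighbours G v"
    | "{x, y} \<in> edges (delete_verts G {v})" "x \<noteq> v" "y \<noteq> v"
    using xy unfolding neighbours_def delete_verts_def
    by (cases "x = v"; cases "y = v") (auto simp: insert_commute)
  then show "(c(v := a)) x \<noteq> (c(v := a)) y"
    using assms(2,3) \<open>x \<noteq> y\<close> by cases (auto simp: proper_colouring_def)
qed

lemma degenerate_colourable:
  assumes "simple_graph G" "degenerate d G"
  shows "\<exists>c :: 'a \<Rightarrow> nat. (\<forall>v. c v \<le> d) \<and> proper_colouring c G"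
  using assms
proof (induction rule: delete_verts_induct)
  case empty
  show ?case by (intro exI[of _ "\<lambda>_. 0"]) (simp add: proper_colouring_def)
next
  case (delete G)
  obtain v where v: "v \<in> verts G" "degree G v \<le> d"
    using delete.prems delete.hyps subgraph_refl unfolding degenerate_def by blast
  have "degenerate d (delete_verts G {v})"
    using delete.prems subgraph_delete_verts[OF delete.hyps(1)] by (rule degenerate_subgraph)
  with delete.IH[of "{v}"] v(1)
  obtain c :: "'a \<Rightarrow> nat" where c: "\<And>u. c u \<le> d" "proper_colouring c (delete_verts G {v})"
    by auto
  have "card (c ` neighbours G v) \<le> d"
    using card_image_le[OF finite_neighbours[OF delete.hyps(1)]] v(2)
    unfolding degree_def by (rule order_trans)
  then have "card (c ` neighbours G v) < card {..d}" by simp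
  moreover have "finite (c ` neighbours G v)" using finite_neighbours[OF delete.hyps(1)] by simp
  ultimately have "\<not> {..d} \<subseteq> c ` neighbours G v" by (meson card_mono not_le)
  then obtain a where a: "a \<le> d" "a \<notin> c ` neighbours G v" by auto
  have "proper_colouring (c(v := a)) G"
    using delete.hyps(1) c(2) a(2) by (rule proper_colouring_extend)
  moreover have "(c(v := a)) u \<le> d" for u using a(1) c(1) by simp
  ultimately show ?case by blast
qed

section \<open>Orientations without walks of a given pattern\<close>

definition orients :: "('a \<times> 'a) set \<Rightarrow> 'a set set \<Rightarrow> bool" where
  "orients A E \<longleftrightarrow> (\<forall>u v. (u, v) \<in> A \<longrightarrow> {u, v} \<in> E) \<and>
     (\<forall>u v. {u, v} \<in> E \<longrightarrow> ((u, v) \<in> A \<longleftrightarrow> (v, u) \<notin> A))"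

definition reduced_walk :: "('a \<times> 'a) set \<Rightarrow> (int \<Rightarrow> bool) \<Rightarrow> (int \<Rightarrow> 'a) \<Rightarrow> bool" where
  "reduced_walk A s f \<longleftrightarrow> (\<forall>i. f (i - 1) \<noteq> f (i + 1)) \<and>
     (\<forall>i. if s i then (f i, f (i + 1)) \<in> A else (f (i + 1), f i) \<in> A)"

definition avoidable :: "(int \<Rightarrow> bool) \<Rightarrow> 'a graph \<Rightarrow> bool" where
  "avoidable s G \<longleftrightarrow> (\<exists>A. orients A (edges G) \<and> (\<forall>f. \<not> reduced_walk A s f))"

definition has_run :: "nat \<Rightarrow> (int \<Rightarrow> bool) \<Rightarrow> bool" where
  "has_run n s \<longleftrightarrow> (\<exists>i. \<forall>j<n. s (i + int j) = s i)"

lemma orientation_of_iff_orients: "orientation_of (verts G, A) G \<longleftrightarrow> orients A (edges G)"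
  by (simp add: orientation_of_def orients_def)

lemma orients_converse: "orients A E \<Longrightarrow> orients (A\<inverse>) E"
  unfolding orients_def by (metis converse_iff insert_commute)

lemma orients_Un:
  assumes A: "orients A E" and B: "orients B F" and disjoint: "E \<inter> F = {}"
  shows "orients (A \<union> B) (E \<union> F)"
  unfolding orients_def
proof (intro conjI allI impI)
  fix u v assume "(u, v) \<in> A \<union> B"
  then show "{u, v} \<in> E \<union> F" using A B by (auto simp: orients_def)
next
  fix u v assume "{u, v} \<in> E \<union> F"
  then consider "{u, v} \<in> E" "(u, v) \<notin> B" "(v, u) \<notin> B" | "{u, v} \<in> F" "(u, v) \<notin> A" "(v, u) \<notin> A"
    using A B disjoint unfolding orients_def by (metis IntI UnE empty_iff insert_commute)
  then show "(u, v) \<in> A \<union> B \<longleftrightarrow> (v, u) \<notin> A \<union> B"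
    using A B unfolding orients_def by cases blast+
qed

lemma orients_incidentI:
  assumes B: "\<forall>(u, v)\<in>B. {u, v} \<in> edges G \<and> {u, v} \<inter> X \<noteq> {} \<and> (v, u) \<notin> B"
    and cover: "\<forall>v\<in>X. \<forall>u\<in>neighbours G v. (u, v) \<in> B \<or> (v, u) \<in> B"
  shows "orients B {e \<in> edges G. e \<inter> X \<noteq> {}}"
  unfolding orients_def
proof (intro conjI allI impI)
  fix u v assume "{u, v} \<in> {e \<in> edges G. e \<inter> X \<noteq> {}}"
  then have "u \<in> neighbours G v" "v \<in> neighbours G u" "u \<in> X \<or> v \<in> X"
    by (auto simp: neighbours_def insert_commute)
  then have "(u, v) \<in> B \<or> (v, u) \<in> B" using cover by blast
  then show "(u, v) \<in> B \<longleftrightarrow> (v, u) \<notin> B" using B by blast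
qed (use B in blast)

lemma reduced_walk_complement: "reduced_walk A (\<lambda>i. \<not> s i) f \<longleftrightarrow> reduced_walk (A\<inverse>) s f"
  by (auto simp: reduced_walk_def)

lemma avoidable_complement: "avoidable (\<lambda>i. \<not> s i) G \<Longrightarrow> avoidable s G"
  unfolding avoidable_def reduced_walk_complement using orients_converse by blast

lemma reduced_walk_step_iff:
  assumes "orients A E" "reduced_walk A s f"
  shows "(f i, f (i + 1)) \<in> A \<longleftrightarrow> s i" "(f (i + 1), f i) \<in> A \<longleftrightarrow> \<not> s i"
  using assms unfolding orients_def reduced_walk_def by (metis insert_commute)+

lemma reduced_walk_neighbours:
  assumes "orients A (edges G)" "reduced_walk A s f"
  shows "f (i - 1) \<in> neighbours G (f i)" "f (i + 1) \<in> neighbours G (f i)"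
proof -
  have step: "{f j, f (j + 1)} \<in> edges G" for j
    using assms unfolding orients_def reduced_walk_def by (metis insert_commute)
  show "f (i - 1) \<in> neighbours G (f i)" using step[of "i - 1"] by (simp add: neighbours_def)
  show "f (i + 1) \<in> neighbours G (f i)"
    using step[of i] by (simp add: neighbours_def insert_commute)
qed

lemma avoidable_extend:
  assumes "avoidable s (delete_verts G X)"
    and B: "orients B {e \<in> edges G. e \<inter> X \<noteq> {}}"
    and miss: "\<And>A f i. orients A (edges G) \<Longrightarrow> B \<subseteq> A \<Longrightarrow> reduced_walk A s f \<Longrightarrow> f i \<notin> X"
  shows "avoidable s G"
proof -
  obtain A where A: "orients A {e \<in> edges G. e \<inter> X = {}}" "\<And>f. \<not> reduced_walk A s f"
    using assms(1) by (auto simp: avoidable_def delete_verts_def)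
  have "{e \<in> edges G. e \<inter> X = {}} \<union> {e \<in> edges G. e \<inter> X \<noteq> {}} = edges G" by blast
  then have AB: "orients (A \<union> B) (edges G)" using orients_Un[OF A(1) B] by auto
  have "\<not> reduced_walk (A \<union> B) s f" for f
  proof
    assume f: "reduced_walk (A \<union> B) s f"
    have "f i \<notin> X" for i using miss[OF AB _ f] by simp
    moreover have "{u, v} \<inter> X \<noteq> {}" if "(u, v) \<in> B" for u v
      using B that unfolding orients_def by blast
    ultimately have "(f i, f j) \<notin> B" for i j by blast
    then have "reduced_walk A s f" using f by (auto simp: reduced_walk_def split: if_splits)
    then show False using A(2) by blast
  qed
  then show ?thesis using AB by (auto simp: avoidable_def)
qed

text \<open>The easy half of the Gallai--Roy theorem: colours increase along directed paths.\<close>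

lemma avoidable_if_colourable_forward_run:
  assumes c: "proper_colouring c G" "\<And>v. c v \<le> d" and run: "\<And>j. j < d + 1 \<Longrightarrow> s (i + int j)"
  shows "avoidable s G"
proof -
  define A where "A = {(u, v). {u, v} \<in> edges G \<and> c u < c v}"
  have "orients A (edges G)"
    using c(1) by (auto simp: orients_def A_def proper_colouring_def insert_commute
        dest: nat_neq_iff[THEN iffD1])
  moreover have "\<not> reduced_walk A s f" for f
  proof
    assume f: "reduced_walk A s f"
    have "c (f i) + n \<le> c (f (i + int n))" if "n \<le> d + 1" for n
      using that
    proof (induction n)
      case (Suc n)
      then have "(f (i + int n), f (i + int n + 1)) \<in> A"
        using f run[of n] by (simp add: reduced_walk_def)
      then show ?case using Suc by (simp add: A_def add.assoc add.commute[of 1])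
    qed simp
    from this[of "d + 1"] show False using c(2)[of "f (i + int (d + 1))"] by simp
  qed
  ultimately show ?thesis by (auto simp: avoidable_def)
qed

lemma avoidable_if_degenerate_has_run:
  assumes "simple_graph G" "degenerate d G" "has_run (d + 1) s"
  shows "avoidable s G"
proof -
  obtain c :: "'a \<Rightarrow> nat" where c: "\<And>v. c v \<le> d" "proper_colouring c G"
    using degenerate_colourable[OF assms(1,2)] by blast
  obtain i where i: "\<And>j. j < d + 1 \<Longrightarrow> s (i + int j) = s i"
    using assms(3) by (auto simp: has_run_def)
  show ?thesis
  proof (cases "s i")
    case True
    then show ?thesis
      using i by (intro avoidable_if_colourable_forward_run[OF c(2,1), of _ i]) simp
  next
    case False
    then have "avoidable (\<lambda>i. \<not> s i) G"
      using i by (intro avoidable_if_colourable_forward_run[OF c(2,1), of _ i]) simp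
    then show ?thesis by (rule avoidable_complement)
  qed
qed

section \<open>Reducible configurations\<close>

definition through_vertex :: "('a \<times> 'a) set \<Rightarrow> 'a graph \<Rightarrow> 'a \<Rightarrow> bool" where
  "through_vertex A G v \<longleftrightarrow> (\<exists>p q. neighbours G v = {p, q} \<and> (p, v) \<in> A \<and> (v, q) \<in> A)"

definition deep_sink :: "(int \<Rightarrow> bool) \<Rightarrow> int \<Rightarrow> bool" where
  "deep_sink s i \<longleftrightarrow> s (i - 2) \<and> s (i - 1) \<and> \<not> s i \<and> \<not> s (i + 1)"

lemma has_run_3_iff: "has_run 3 s \<longleftrightarrow> (\<exists>i. s (i - 1) = s i \<and> s i = s (i + 1))"
proof
  assume "has_run 3 s"
  then obtain i where "s (i + 1) = s i" "s (i + 2) = s i"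
    by (force simp: has_run_def numeral_3_eq_3 All_less_Suc)
  then show "\<exists>i. s (i - 1) = s i \<and> s i = s (i + 1)"
    by (intro exI[of _ "i + 1"]) (simp add: add.assoc)
next
  assume "\<exists>i. s (i - 1) = s i \<and> s i = s (i + 1)"
  then obtain i where "s (i - 1) = s i" "s i = s (i + 1)" by blast
  then show "has_run 3 s"
    unfolding has_run_def
    by (intro exI[of _ "i - 1"]) (simp add: numeral_3_eq_3 All_less_Suc add.commute)
qed

lemma reduced_walk_two_neighbours:
  assumes "orients A (edges G)" "reduced_walk A s f" "neighbours G (f i) = {p, q}"
  shows "f (i - 1) = p \<and> f (i + 1) = q \<or> f (i - 1) = q \<and> f (i + 1) = p"
proof -
  have "f (i - 1) \<noteq> f (i + 1)" using assms(2) by (simp add: reduced_walk_def)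
  then show ?thesis using reduced_walk_neighbours[OF assms(1,2), of i] assms(3) by auto
qed

lemma reduced_walk_degree_ge_two:
  assumes "simple_graph G" "orients A (edges G)" "reduced_walk A s f"
  shows "degree G (f i) \<ge> 2"
proof -
  have "f (i - 1) \<noteq> f (i + 1)" using assms(3) by (simp add: reduced_walk_def)
  then have "2 = card {f (i - 1), f (i + 1)}" by simp
  also have "\<dots> \<le> card (neighbours G (f i))"
    using reduced_walk_neighbours[OF assms(2,3), of i]
    by (intro card_mono finite_neighbours[OF assms(1)]) simp
  finally show ?thesis by (simp add: degree_def)
qed

lemma reduced_walk_through_vertex:
  assumes "orients A (edges G)" "reduced_walk A s f" "through_vertex A G (f i)"
  shows "s (i - 1) = s i"
proof -
  obtain p q where pq: "neighbours G (f i) = {p, q}" "(p, f i) \<in> A" "(f i, q) \<in> A"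
    using assms(3) by (auto simp: through_vertex_def)
  then show ?thesis
    using reduced_walk_two_neighbours[OF assms(1,2) pq(1)]
      reduced_walk_step_iff[OF assms(1,2), of i] reduced_walk_step_iff[OF assms(1,2), of "i - 1"]
    by auto
qed

lemma reduced_walk_misses_adjacent_through_vertices:
  assumes ori: "orients A (edges G)" and f: "reduced_walk A s f" and no_run: "\<not> has_run 3 s"
    and through: "through_vertex A G v" "through_vertex A G w" and adj: "w \<in> neighbours G v"
  shows "f i \<noteq> v"
proof
  assume hit: "f i = v"
  obtain p q where "neighbours G v = {p, q}" using through(1) by (auto simp: through_vertex_def)
  then have "w = f (i - 1) \<or> w = f (i + 1)"
    using reduced_walk_two_neighbours[OF ori f, of i] hit adj by auto
  then have "s (i - 2) = s (i - 1) \<or> s i = s (i + 1)"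
    using reduced_walk_through_vertex[OF ori f, of "i - 1"]
      reduced_walk_through_vertex[OF ori f, of "i + 1"] through(2) by auto
  moreover have "s (i - 1) = s i"
    using reduced_walk_through_vertex[OF ori f] through(1) hit by blast
  ultimately have "\<exists>j\<in>{i - 1, i}. s (j - 1) = s j \<and> s j = s (j + 1)" by auto
  then show False using no_run has_run_3_iff by blast
qed

lemma reduced_walk_misses_tee:
  assumes ori: "orients A (edges G)" and f: "reduced_walk A s f"
    and no_run: "\<not> has_run 3 s" and no_sink: "\<And>i. \<not> deep_sink s i"
    and nbs: "neighbours G x = {y1, y2, w}"
    and through: "through_vertex A G y1" "through_vertex A G y2"
    and arcs: "(y1, x) \<in> A" "(y2, x) \<in> A" "(x, w) \<in> A"
  shows "f i \<noteq> x"
proof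
  assume hit: "f i = x"
  note step = reduced_walk_step_iff[OF ori f, of "i - 1"] reduced_walk_step_iff[OF ori f, of i]
  have before: "s (i - 2) = s (i - 1)" if "f (i - 1) \<in> {y1, y2}"
    using reduced_walk_through_vertex[OF ori f, of "i - 1"] through that by auto
  have after: "s i = s (i + 1)" if "f (i + 1) \<in> {y1, y2}"
    using reduced_walk_through_vertex[OF ori f, of "i + 1"] through that by auto
  have "f (i - 1) \<noteq> f (i + 1)" using f by (simp add: reduced_walk_def)
  then consider (sink) "f (i - 1) \<in> {y1, y2}" "f (i + 1) \<in> {y1, y2}"
    | (out) "f (i - 1) \<in> {y1, y2}" "f (i + 1) = w" | (into) "f (i - 1) = w" "f (i + 1) \<in> {y1, y2}"
    using reduced_walk_neighbours[OF ori f, of i] nbs hit by auto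
  then show False
  proof cases
    case sink
    then have "deep_sink s i" using before after step arcs hit by (auto simp: deep_sink_def)
    then show False using no_sink by blast
  next
    case out
    then have "s (i - 2) = s (i - 1)" "s (i - 1) = s i" using before step arcs hit by auto
    then have "has_run 3 s" unfolding has_run_3_iff by (intro exI[of _ "i - 1"]) simp
    then show False using no_run by blast
  next
    case into
    then have "s (i - 1) = s i" "s i = s (i + 1)" using after step arcs hit by auto
    then show False using no_run has_run_3_iff by blast
  qed
qed

lemma avoidable_delete_degree_le_one:
  assumes G: "simple_graph G" and deg: "degree G v \<le> 1"
    and del: "avoidable s (delete_verts G {v})"
  shows "avoidable s G"
proof (rule avoidable_extend[OF del])
  show "orients ((\<lambda>u. (u, v)) ` neighbours G v) {e \<in> edges G. e \<inter> {v} \<noteq> {}}"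
    using edge_ends_distinct[OF G] by (intro orients_incidentI) (auto simp: neighbours_def)
  fix A f i
  assume "orients A (edges G)" "reduced_walk A s f"
  from reduced_walk_degree_ge_two[OF G this, of i] show "f i \<notin> {v}" using deg by auto
qed

lemma degree_two_neighboursE:
  assumes "degree G v = 2" "u \<in> neighbours G v"
  obtains w where "neighbours G v = {w, u}" "w \<noteq> u"
proof -
  have "card (neighbours G v - {u}) = 1" using assms by (simp add: degree_def)
  then obtain w where "neighbours G v - {u} = {w}" by (rule card_1_singletonE)
  then show thesis using that assms(2) by blast
qed

lemma avoidable_delete_adjacent_degree_two:
  assumes G: "simple_graph G" and no_run: "\<not> has_run 3 s"
    and vs: "{v1, v2} \<in> edges G" "degree G v1 = 2" "degree G v2 = 2"
    and del: "avoidable s (delete_verts G {v1, v2})"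
  shows "avoidable s G"
proof -
  have adj: "v2 \<in> neighbours G v1" "v1 \<in> neighbours G v2"
    using vs(1) by (simp_all add: neighbours_def insert_commute)
  obtain u where u: "neighbours G v1 = {u, v2}" "u \<noteq> v2"
    using degree_two_neighboursE[OF vs(2) adj(1)] .
  obtain w where w: "neighbours G v2 = {w, v1}" "w \<noteq> v1"
    using degree_two_neighboursE[OF vs(3) adj(2)] .
  have "u \<in> neighbours G v1" "w \<in> neighbours G v2" using u(1) w(1) by simp_all
  then have path_edges: "{u, v1} \<in> edges G" "{v1, v2} \<in> edges G" "{v2, w} \<in> edges G"
    using vs(1) by (simp_all add: neighbours_def insert_commute)
  let ?B = "{(u, v1), (v1, v2), (v2, w)}"
  show ?thesis
  proof (rule avoidable_extend[OF del, of ?B])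
    show "orients ?B {e \<in> edges G. e \<inter> {v1, v2} \<noteq> {}}"
      using u w path_edges path_edges[THEN edge_ends_distinct[OF G]]
      by (intro orients_incidentI) simp_all
    fix A f i
    assume ori: "orients A (edges G)" and "?B \<subseteq> A" and f: "reduced_walk A s f"
    then have "through_vertex A G v1" "through_vertex A G v2"
      using u(1) w(1) unfolding through_vertex_def by blast+
    then show "f i \<notin> {v1, v2}"
      using reduced_walk_misses_adjacent_through_vertices[OF ori f no_run] adj by blast
  qed
qed

lemma degree_three_teeE:
  assumes deg: "degree G x = 3" "card (degree_two_neighbours G x) \<ge> 2"
  obtains y1 y2 w where "neighbours G x = {y1, y2, w}" "w \<noteq> y1" "w \<noteq> y2" "y1 \<noteq> y2"
    "degree G y1 = 2" "degree G y2 = 2"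
proof -
  obtain Y where Y: "Y \<subseteq> degree_two_neighbours G x" "card Y = 2"
    by (rule obtain_subset_with_card_n[OF deg(2)]) (rule that)
  then obtain y1 y2 where y: "Y = {y1, y2}" "y1 \<noteq> y2" by (auto simp: card_2_iff)
  have y_nb: "{y1, y2} \<subseteq> neighbours G x" and y_deg: "degree G y1 = 2" "degree G y2 = 2"
    using Y(1) y(1) by (auto simp: degree_two_neighbours_def)
  then have "card (neighbours G x - {y1, y2}) = 1"
    using deg(1) y(2) by (simp add: card_Diff_subset degree_def)
  then obtain w where "neighbours G x - {y1, y2} = {w}" by (rule card_1_singletonE)
  then have "neighbours G x = {y1, y2, w}" "w \<noteq> y1" "w \<noteq> y2" using y_nb by blast+
  then show thesis using y(2) y_deg by (rule that)
qed

lemma avoidable_delete_tee: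
  assumes G: "simple_graph G" and no_run: "\<not> has_run 3 s" and no_sink: "\<And>i. \<not> deep_sink s i"
    and x: "neighbours G x = {y1, y2, w}" "w \<noteq> y1" "w \<noteq> y2" "y1 \<noteq> y2"
    and y: "degree G y1 = 2" "degree G y2 = 2" "{y1, y2} \<notin> edges G"
    and del: "avoidable s (delete_verts G {x, y1, y2})"
  shows "avoidable s G"
proof -
  have adj: "x \<in> neighbours G y1" "x \<in> neighbours G y2"
    using x(1) neighbours_sym[of x G] by simp_all
  obtain z1 where z1: "neighbours G y1 = {z1, x}" "z1 \<noteq> x"
    using degree_two_neighboursE[OF y(1) adj(1)] .
  obtain z2 where z2: "neighbours G y2 = {z2, x}" "z2 \<noteq> x"
    using degree_two_neighboursE[OF y(2) adj(2)] .
  have "z1 \<in> neighbours G y1" "z2 \<in> neighbours G y2" using z1(1) z2(1) by simp_all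
  moreover have "y1 \<in> neighbours G x" "y2 \<in> neighbours G x" "w \<in> neighbours G x"
    using x(1) by simp_all
  ultimately have tee_edges: "{z1, y1} \<in> edges G" "{y1, x} \<in> edges G" "{z2, y2} \<in> edges G"
    "{y2, x} \<in> edges G" "{x, w} \<in> edges G"
    by (simp_all add: neighbours_def insert_commute)
  then have z_neq: "z1 \<noteq> y2" "z2 \<noteq> y1" using y(3) by (auto simp: insert_commute)
  let ?B = "{(z1, y1), (y1, x), (z2, y2), (y2, x), (x, w)}"
  show ?thesis
  proof (rule avoidable_extend[OF del, of ?B])
    show "orients ?B {e \<in> edges G. e \<inter> {x, y1, y2} \<noteq> {}}"
      using x z1 z2 z_neq tee_edges tee_edges[THEN edge_ends_distinct[OF G]]
      by (intro orients_incidentI) simp_all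
    fix A f i
    assume ori: "orients A (edges G)" and B: "?B \<subseteq> A" and f: "reduced_walk A s f"
    have "through_vertex A G y1" "through_vertex A G y2"
      using B z1(1) z2(1) unfolding through_vertex_def by blast+
    then have miss_x: "f j \<noteq> x" for j
      using reduced_walk_misses_tee[OF ori f no_run no_sink x(1)] B by simp
    have "f i \<noteq> y" if "neighbours G y = {z, x}" for y z
      using reduced_walk_two_neighbours[OF ori f, of i z x] miss_x that by auto
    then show "f i \<notin> {x, y1, y2}" using miss_x z1(1) z2(1) by simp
  qed
qed

section \<open>Sparse graphs\<close>

definition sparse :: "nat \<Rightarrow> 'a graph \<Rightarrow> bool" where
  "sparse k G \<longleftrightarrow> (\<forall>J. subgraph J G \<longrightarrow> verts J \<noteq> {} \<longrightarrow>
     k * card (edges J) < (k + 1) * card (verts J))"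

lemma sparse_subgraph: "sparse k G \<Longrightarrow> subgraph H G \<Longrightarrow> sparse k H"
  unfolding sparse_def using subgraph_trans by blast

lemma sparse_card_edges:
  assumes "simple_graph G" "sparse k G" "verts G \<noteq> {}"
  shows "k * card (edges G) < (k + 1) * card (verts G)"
  using assms unfolding sparse_def using subgraph_refl by blast

lemma sparse_degenerate:
  assumes "sparse k G" "k \<ge> 2"
  shows "degenerate 2 G"
  unfolding degenerate_def
proof (intro allI impI)
  fix J assume J: "subgraph J G" "verts J \<noteq> {}"
  have "2 * (k * card (edges J)) < 2 * ((k + 1) * card (verts J))"
    using assms(1) J unfolding sparse_def by (intro mult_strict_left_mono) auto
  also have "\<dots> \<le> k * (3 * card (verts J))"
    using mult_right_mono[OF assms(2), of "card (verts J)"] by (simp add: algebra_simps)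
  finally have "k * (2 * card (edges J)) < k * (3 * card (verts J))" by (simp add: ac_simps)
  then have "2 * card (edges J) < (2 + 1) * card (verts J)" by simp
  then show "\<exists>v\<in>verts J. degree J v \<le> 2"
    using J(1) by (intro exists_degree_le) (simp add: subgraph_def)
qed

text \<open>Discharging: a vertex \<open>v\<close> has charge \<open>k * degree G v - (2 * k + 2)\<close>, and every vertex gives one
  unit to each neighbour of degree two.\<close>

lemma discharge_degree_two:
  assumes G: "simple_graph G"
    and indep: "\<And>u v. {u, v} \<in> edges G \<Longrightarrow> degree G u = 2 \<Longrightarrow> degree G v \<noteq> 2"
    and charge: "\<And>v. v \<in> verts G \<Longrightarrow> degree G v \<noteq> 2 \<Longrightarrow>
      card (degree_two_neighbours G v) + (2 * k + 2) \<le> k * degree G v"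
  shows "(k + 1) * card (verts G) \<le> k * card (edges G)"
proof -
  define S where "S = {v \<in> verts G. degree G v = 2}"
  define T where "T = {v \<in> verts G. degree G v \<noteq> 2}"
  have ST: "finite S" "finite T" "S \<inter> T = {}" "verts G = S \<union> T"
    using simple_graph_finite_verts[OF G] by (auto simp: S_def T_def)
  have S_nbs: "neighbours G v \<inter> T = neighbours G v" if "v \<in> S" for v
    using that indep neighbours_subset_verts[OF G, of v] by (auto simp: S_def T_def neighbours_def)
  have T_nbs: "neighbours G v \<inter> S = degree_two_neighbours G v" for v
    using neighbours_subset_verts[OF G, of v] by (auto simp: S_def degree_two_neighbours_def)
  have S_deg: "(\<Sum>v\<in>S. degree G v) = 2 * card S" by (simp add: S_def)
  have "2 * card S = (\<Sum>v\<in>S. card (neighbours G v \<inter> T))"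
    by (simp add: S_nbs S_deg flip: degree_def)
  also have "\<dots> = (\<Sum>v\<in>T. card (degree_two_neighbours G v))"
    unfolding sum_card_neighbours_Int_swap[OF ST(1,2)] T_nbs ..
  finally have "2 * card S + (2 * k + 2) * card T
      = (\<Sum>v\<in>T. card (degree_two_neighbours G v) + (2 * k + 2))"
    by (simp only: sum.distrib sum_constant of_nat_id mult.commute[of "card T"] distrib_right)
  also have "\<dots> \<le> (\<Sum>v\<in>T. k * degree G v)" by (rule sum_mono) (use charge in \<open>simp add: T_def\<close>)
  finally have "2 * card S + (2 * k + 2) * card T \<le> k * (\<Sum>v\<in>T. degree G v)"
    by (simp add: sum_distrib_left)
  moreover have "2 * card (edges G) = 2 * card S + (\<Sum>v\<in>T. degree G v)"
    using sum_degree[OF G] ST by (simp add: sum.union_disjoint S_deg)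
  then have "k * (2 * card (edges G)) = k * (2 * card S) + k * (\<Sum>v\<in>T. degree G v)"
    by (simp add: distrib_left)
  moreover have "card (verts G) = card S + card T" using ST by (simp add: card_Un_disjoint)
  ultimately have "2 * ((k + 1) * card (verts G)) \<le> 2 * (k * card (edges G))"
    by (simp add: algebra_simps)
  then show ?thesis by simp
qed

lemma sparse_configuration:
  assumes G: "simple_graph G" "sparse k G" "verts G \<noteq> {}" and k: "k \<ge> 3"
  obtains
    (low) v where "v \<in> verts G" "degree G v \<le> 1"
  | (pair) u v where "{u, v} \<in> edges G" "degree G u = 2" "degree G v = 2"
  | (tee) x where "k < 5" "x \<in> verts G" "degree G x = 3" "card (degree_two_neighbours G x) \<ge> 2"
      "\<And>u v. {u, v} \<in> edges G \<Longrightarrow> degree G u = 2 \<Longrightarrow> degree G v \<noteq> 2"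
proof (rule ccontr)
  assume neg: "\<not> thesis"
  have indep: "degree G v \<noteq> 2" if "{u, v} \<in> edges G" "degree G u = 2" for u v
    using neg pair that by blast
  have "(k + 1) * card (verts G) \<le> k * card (edges G)"
  proof (rule discharge_degree_two[OF G(1) indep])
    fix v assume v: "v \<in> verts G" "degree G v \<noteq> 2"
    let ?n = "card (degree_two_neighbours G v)"
    have "?n \<le> degree G v"
      unfolding degree_def degree_two_neighbours_def
      by (intro card_mono finite_neighbours[OF G(1)]) auto
    have "degree G v \<ge> 3" using neg low[of v] v by linarith
    then consider (deg3_tee) "k < 5" "degree G v = 3" | (deg3) "k \<ge> 5" "degree G v = 3"
      | (deg4) "degree G v \<ge> 4" by linarith
    then show "?n + (2 * k + 2) \<le> k * degree G v"
    proof cases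
      case deg3_tee
      then have "?n < 2" using neg tee[of v] v(1) indep by (meson not_le)
      then show ?thesis using deg3_tee k by simp
    next
      case deg3
      then show ?thesis using \<open>?n \<le> degree G v\<close> by simp
    next
      case deg4
      then obtain m where m: "degree G v = 4 + m" using le_Suc_ex by blast
      then have "k * degree G v = 4 * k + k * m" by (simp add: distrib_left)
      moreover have "1 * m \<le> k * m" using k by (intro mult_right_mono) auto
      ultimately show ?thesis using \<open>?n \<le> degree G v\<close> m k by linarith
    qed
  qed
  then show False using sparse_card_edges[OF G] by simp
qed

lemma avoidable_if_sparse_sink_free:
  assumes "simple_graph G" "sparse k G" and k: "k \<ge> 3" and no_run: "\<not> has_run 3 s"
    and no_sink: "\<And>i. k < 5 \<Longrightarrow> \<not> deep_sink s i"
  shows "avoidable s G"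
  using assms(1,2)
proof (induction rule: delete_verts_induct)
  case empty
  show ?case by (auto simp: avoidable_def orients_def reduced_walk_def)
next
  case (delete G)
  note G = delete.hyps(1)
  have IH: "avoidable s (delete_verts G X)" if "x \<in> X" "x \<in> verts G" for X x
    using that
    by (intro delete.IH sparse_subgraph[OF delete.prems subgraph_delete_verts[OF G]]) blast
  from G delete.prems delete.hyps(2) k show ?case
  proof (cases rule: sparse_configuration)
    case (low v)
    show ?thesis using G low(2) IH[OF _ low(1)] by (rule avoidable_delete_degree_le_one) simp
  next
    case (pair u v)
    then have "u \<in> verts G" using G by (auto simp: simple_graph_def)
    show ?thesis
      using G no_run pair IH[OF _ \<open>u \<in> verts G\<close>] by (rule avoidable_delete_adjacent_degree_two) simp
  next
    case (tee x)
    obtain y1 y2 w where y: "neighbours G x = {y1, y2, w}" "w \<noteq> y1" "w \<noteq> y2" "y1 \<noteq> y2"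
      "degree G y1 = 2" "degree G y2 = 2"
      using degree_three_teeE[OF tee(3,4)] .
    have "{y1, y2} \<notin> edges G" using tee(5) y(5,6) by blast
    then show ?thesis
      by (rule avoidable_delete_tee[OF G no_run no_sink[OF tee(1)] y]) (use IH[OF _ tee(2)] in simp)
  qed
qed

lemma avoidable_if_sparse_sink_or_source_free:
  assumes "simple_graph G" "sparse k G" "k \<ge> 3" "\<not> has_run 3 s"
    and "k < 5 \<Longrightarrow> (\<forall>i. \<not> deep_sink s i) \<or> (\<forall>i. \<not> deep_sink (\<lambda>i. \<not> s i) i)"
  shows "avoidable s G"
proof (cases "k < 5 \<longrightarrow> (\<forall>i. \<not> deep_sink s i)")
  case True
  then show ?thesis using assms(1-4) by (intro avoidable_if_sparse_sink_free) auto
next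
  case False
  then have "avoidable (\<lambda>i. \<not> s i) G"
    using assms by (intro avoidable_if_sparse_sink_free) (auto simp: has_run_def)
  then show ?thesis by (rule avoidable_complement)
qed

section \<open>Densities\<close>

lemma finite_subgraphs:
  assumes "simple_graph G"
  shows "finite {J. subgraph J G}"
proof (rule finite_subset)
  show "{J. subgraph J G} \<subseteq> Pow (verts G) \<times> Pow (edges G)"
    by (auto simp: subgraph_def)
  show "finite (Pow (verts G) \<times> Pow (edges G))"
    using simple_graph_finite_verts[OF assms] simple_graph_finite_edges[OF assms] by simp
qed

lemma density_le_max_density:
  assumes "simple_graph G" "subgraph J G" "card (verts J) \<ge> 1"
  shows "real (card (edges J)) / real (card (verts J)) \<le> max_density G"
  unfolding max_density_def
proof (rule Max_ge)
  let ?d = "\<lambda>J :: 'a graph. real (card (edges J)) / real (card (verts J))"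
  show "finite {?d J |J. subgraph J G \<and> card (verts J) \<ge> 1}"
    using finite_subgraphs[OF assms(1)] by (rule finite_surj[of _ _ ?d]) blast
qed (use assms in blast)

lemma sparse_if_max_density_less:
  assumes G: "simple_graph G" and k: "k \<ge> 1" and dens: "max_density G < (real k + 1) / real k"
  shows "sparse k G"
  unfolding sparse_def
proof (intro allI impI)
  fix J assume J: "subgraph J G" "verts J \<noteq> {}"
  then have pos: "card (verts J) > 0"
    by (auto simp: subgraph_def simple_graph_def card_gt_0_iff)
  then have "real (card (edges J)) / real (card (verts J)) < (real k + 1) / real k"
    using density_le_max_density[OF G J(1)] dens by simp
  then have "real (k * card (edges J)) < real ((k + 1) * card (verts J))"
    using pos k by (simp add: divide_less_eq less_divide_eq algebra_simps)
  then show "k * card (edges J) < (k + 1) * card (verts J)" by linarith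
qed

lemma simple_graph_cycle_graph:
  assumes "l \<ge> 2"
  shows "simple_graph (cycle_graph l)"
proof -
  have "i \<noteq> (i + 1) mod l" if "i < l" for i
    using that assms by (cases "i + 1 = l") auto
  then show ?thesis using assms by (auto simp: simple_graph_def cycle_graph_def card_insert_if)
qed

lemma card_edges_cycle_graph:
  assumes "l \<ge> 3"
  shows "card (edges (cycle_graph l)) = l"
proof -
  have "inj_on (\<lambda>i. {i, (i + 1) mod l}) {..<l}"
  proof (rule inj_onI)
    fix i j assume ij: "i \<in> {..<l}" "j \<in> {..<l}" "{i, (i + 1) mod l} = {j, (j + 1) mod l}"
    show "i = j"
    proof (rule ccontr)
      assume "i \<noteq> j"
      then have "i = (j + 1) mod l" "j = (i + 1) mod l"
        using ij(3) by (auto simp: doubleton_eq_iff)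
      then have "i = ((i + 1) mod l + 1) mod l" by simp
      then have "(i + 2) mod l = i mod l" using ij(1) by (simp add: mod_Suc_eq)
      then have "l dvd 2" using mod_eq_dvd_iff_nat[of i "i + 2" l] by simp
      then show False using assms by (auto dest: dvd_imp_le)
    qed
  qed
  then have "card ((\<lambda>i. {i, (i + 1) mod l}) ` {..<l}) = l" by (simp add: card_image)
  moreover have "edges (cycle_graph l) = (\<lambda>i. {i, (i + 1) mod l}) ` {..<l}"
    by (auto simp: cycle_graph_def)
  ultimately show ?thesis by simp
qed

lemma successor_closed_eq_lessThan:
  fixes W :: "nat set" and l :: nat
  assumes "W \<subseteq> {..<l}" "W \<noteq> {}" and closed: "\<And>i. i \<in> W \<Longrightarrow> (i + 1) mod l \<in> W"
  shows "W = {..<l}"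
proof
  obtain i where i: "i \<in> W" using assms(2) by blast
  have "i < l" using i assms(1) by auto
  have reach: "(i + n) mod l \<in> W" for n
  proof (induction n)
    case 0
    then show ?case using i \<open>i < l\<close> by simp
  next
    case (Suc n)
    then show ?case using closed[OF Suc] by (simp add: mod_Suc_eq)
  qed
  show "{..<l} \<subseteq> W"
  proof
    fix a assume "a \<in> {..<l}"
    then have "(i + (a + l - i)) mod l = a" using \<open>i < l\<close> by simp
    then show "a \<in> W" using reach by metis
  qed
qed (rule assms(1))

lemma card_edges_proper_subgraph_cycle_graph:
  assumes J: "subgraph J (cycle_graph l)" and V: "verts J \<noteq> {}" "verts J \<noteq> {..<l}"
  shows "card (edges J) < card (verts J)"
proof -
  let ?W = "{i \<in> verts J. (i + 1) mod l \<in> verts J}"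
  have sub: "verts J \<subseteq> {..<l}" and fin: "finite (verts J)"
    using J by (auto simp: subgraph_def simple_graph_def cycle_graph_def)
  have "edges J \<subseteq> (\<lambda>i. {i, (i + 1) mod l}) ` ?W"
  proof
    fix e assume "e \<in> edges J"
    then have "e \<in> edges (cycle_graph l)" "e \<subseteq> verts J"
      using J by (auto simp: subgraph_def simple_graph_def)
    then show "e \<in> (\<lambda>i. {i, (i + 1) mod l}) ` ?W" by (auto simp: cycle_graph_def)
  qed
  then have "card (edges J) \<le> card ?W" using fin by (intro surj_card_le) auto
  also have "?W \<noteq> verts J" using successor_closed_eq_lessThan[OF sub V(1)] V(2) by blast
  then have "card ?W < card (verts J)" using fin by (intro psubset_card_mono) auto
  finally show ?thesis .
qed

lemma max_2_density_cycle_graph: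
  assumes l: "l \<ge> 3"
  shows "max_2_density (cycle_graph l) = (real l - 1) / (real l - 2)"
  unfolding max_2_density_def
proof (rule Max_eqI)
  have simple: "simple_graph (cycle_graph l)" using l by (intro simple_graph_cycle_graph) simp
  let ?d = "\<lambda>J :: nat graph. (real (card (edges J)) - 1) / (real (card (verts J)) - 2)"
  let ?M = "{?d J |J. subgraph J (cycle_graph l) \<and> card (verts J) \<ge> 3}"
  have card_verts: "card (verts (cycle_graph l)) = l" by (simp add: cycle_graph_def)
  show "finite ?M" using finite_subgraphs[OF simple] by (rule finite_surj[of _ _ ?d]) blast
  have "?d (cycle_graph l) \<in> ?M"
    using subgraph_refl[OF simple] l
    by (intro CollectI exI[of _ "cycle_graph l"]) (simp add: card_verts)
  then show "(real l - 1) / (real l - 2) \<in> ?M"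
    by (simp add: card_verts card_edges_cycle_graph[OF l])
  fix r assume "r \<in> ?M"
  then obtain J where r: "r = ?d J" and J: "subgraph J (cycle_graph l)" "card (verts J) \<ge> 3"
    by blast
  show "r \<le> (real l - 1) / (real l - 2)"
  proof (cases "verts J = {..<l}")
    case True
    moreover have "card (edges J) \<le> l"
      using J(1) card_mono[OF simple_graph_finite_edges[OF simple], of "edges J"]
      by (simp add: subgraph_def card_edges_cycle_graph[OF l])
    ultimately show ?thesis using l by (simp add: r divide_right_mono)
  next
    case False
    then have "card (edges J) < card (verts J)"
      using J by (intro card_edges_proper_subgraph_cycle_graph) auto
    then have "r \<le> 1" using J(2) by (simp add: r divide_le_eq)
    also have "1 \<le> (real l - 1) / (real l - 2)" using l by (simp add: le_divide_eq)
    finally show ?thesis .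
  qed
qed

section \<open>Oriented cycles\<close>

definition cycle_pattern :: "nat digraph \<Rightarrow> nat \<Rightarrow> int \<Rightarrow> bool" where
  "cycle_pattern C l i \<longleftrightarrow> (nat (i mod int l), nat ((i + 1) mod int l)) \<in> arcs C"

lemma cycle_pattern_cong:
  assumes "i mod int l = j mod int l"
  shows "cycle_pattern C l i = cycle_pattern C l j"
  unfolding cycle_pattern_def using assms mod_add_cong[OF assms refl[of "1 mod int l"]] by simp

lemma reduced_walk_if_contains_copy:
  assumes l: "l \<ge> 3" and C: "orientation_of C (cycle_graph l)" and copy: "contains_copy (V, A) C"
  shows "\<exists>f. reduced_walk A (cycle_pattern C l) f"
proof -
  have "dverts C = {..<l}" using C by (simp add: orientation_of_def cycle_graph_def)
  then obtain g where g: "inj_on g {..<l}" "\<And>u v. (u, v) \<in> arcs C \<Longrightarrow> (g u, g v) \<in> A"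
    using copy unfolding contains_copy_def by fastforce
  define pos where "pos i = nat (i mod int l)" for i
  have pos_less: "pos i < l" for i using l by (simp add: pos_def nat_less_iff)
  have pos_Suc: "pos (i + 1) = (pos i + 1) mod l" for i
  proof -
    have "int (pos (i + 1)) = int ((pos i + 1) mod l)"
      using l by (simp add: pos_def zmod_int mod_add_right_eq add.commute)
    then show ?thesis by linarith
  qed
  have "g (pos (i - 1)) \<noteq> g (pos (i + 1))" for i
  proof
    assume "g (pos (i - 1)) = g (pos (i + 1))"
    then have "pos (i + 1) = pos (i - 1)" using g(1) pos_less by (auto simp: inj_on_def)
    then have "(i + 1) mod int l = (i - 1) mod int l" using l by (simp add: pos_def nat_eq_iff2)
    then have "int l dvd 2" using mod_eq_dvd_iff[of "i + 1" "int l" "i - 1"] by simp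
    then show False using l by (auto dest: zdvd_imp_le)
  qed
  moreover have "if cycle_pattern C l i then (g (pos i), g (pos (i + 1))) \<in> A
    else (g (pos (i + 1)), g (pos i)) \<in> A" for i
  proof -
    have "{pos i, pos (i + 1)} \<in> edges (cycle_graph l)"
      using pos_less[of i] by (auto simp: pos_Suc cycle_graph_def)
    then have "(pos i, pos (i + 1)) \<in> arcs C \<longleftrightarrow> (pos (i + 1), pos i) \<notin> arcs C"
      using C unfolding orientation_of_def by blast
    then show ?thesis using g(2) by (simp add: cycle_pattern_def flip: pos_def)
  qed
  ultimately show ?thesis unfolding reduced_walk_def by (intro exI[of _ "\<lambda>i. g (pos i)"]) blast
qed

text \<open>A deep sink and a deep source together take three blocks (maximal directed paths) of length two,
  or two if \<open>l = 4\<close>. The number of blocks is even, so otherwise the cycle has at least seven edges.\<close>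

lemma deep_sink_free_if_short_period:
  fixes s :: "int \<Rightarrow> bool"
  assumes l: "l = 5 \<or> l = 6" and periodic: "\<And>i j. i mod l = j mod l \<Longrightarrow> s i = s j"
    and no_run: "\<not> has_run 3 s"
  shows "(\<forall>i. \<not> deep_sink s i) \<or> (\<forall>i. \<not> deep_sink (\<lambda>i. \<not> s i) i)"
proof (rule ccontr)
  assume "\<not> ?thesis"
  then obtain i j where sink: "deep_sink s i" and source: "deep_sink (\<lambda>i. \<not> s i) j" by blast
  define t where "t a = s (i - 2 + a)" for a
  have t_mod: "t a = t (a mod l)" for a
    unfolding t_def by (rule periodic) (simp add: mod_add_right_eq)
  have no_run_t: "\<not> (t (a - 1) = t a \<and> t a = t (a + 1))" for a
    using no_run unfolding has_run_3_iff t_def by (metis add.assoc add_diff_eq)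
  have t03: "t 0" "t 1" "\<not> t 2" "\<not> t 3"
    using sink by (simp_all add: t_def deep_sink_def add.commute)
  have t4: "t 4" using no_run_t[of 3] t03 by simp
  have l: "l = 6" using l no_run_t[of 5] t_mod[of 5] t_mod[of 6] t03 t4 by auto
  have t5: "\<not> t 5" using no_run_t[of 5] t_mod[of 6] l t03 t4 by simp
  define q where "q = (j - i) mod 6"
  have shift: "s (j - 2 + c) = t ((q + c) mod 6)" for c
  proof -
    have "s (j - 2 + c) = t (j - i + c)" by (simp add: t_def algebra_simps)
    then show ?thesis using t_mod[of "j - i + c"] by (simp add: q_def l mod_add_left_eq)
  qed
  have t_q: "\<not> t ((q + 0) mod 6)" "\<not> t ((q + 1) mod 6)" "t ((q + 2) mod 6)" "t ((q + 3) mod 6)"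
    using source unfolding shift[symmetric] by (simp_all add: deep_sink_def algebra_simps)
  have "0 \<le> q" "q < 6" by (simp_all add: q_def)
  then consider "q = 0" | "q = 1" | "q = 2" | "q = 3" | "q = 4" | "q = 5" by linarith
  then show False by cases (use t_q t03 t4 t5 in simp_all)
qed

theorem theorem17:
  fixes l :: nat and C :: "nat digraph" and G :: "'a graph"
  assumes "l \<ge> 5"
    and "orientation_of C (cycle_graph l)"
    and "simple_graph G"
    and "max_density G < max_2_density (cycle_graph l)"
  shows "\<not> arrows G C"
proof -
  define s where "s = cycle_pattern C l"
  have "max_density G < (real (l - 2) + 1) / real (l - 2)"
    using assms(1,4) by (simp add: max_2_density_cycle_graph algebra_simps)
  then have sparse: "sparse (l - 2) G"
    using assms(1,3) by (intro sparse_if_max_density_less) auto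
  have "avoidable s G"
  proof (cases "has_run 3 s")
    case True
    then show ?thesis
      using avoidable_if_degenerate_has_run[OF assms(3) sparse_degenerate[OF sparse]] assms(1)
      by simp
  next
    case no_run: False
    have "(\<forall>i. \<not> deep_sink s i) \<or> (\<forall>i. \<not> deep_sink (\<lambda>i. \<not> s i) i)" if "l < 7"
      using that assms(1) no_run unfolding s_def
      by (intro deep_sink_free_if_short_period[of "int l"] cycle_pattern_cong) auto
    then show ?thesis
      using assms(1)
      by (intro avoidable_if_sparse_sink_or_source_free[OF assms(3) sparse _ no_run]) auto
  qed
  then obtain A where A: "orientation_of (verts G, A) G" "\<And>f. \<not> reduced_walk A s f"
    by (auto simp: avoidable_def orientation_of_iff_orients)
  have "\<not> contains_copy (verts G, A) C"
    using reduced_walk_if_contains_copy[OF _ assms(2)] A(2) assms(1) unfolding s_def by fastforce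
  then show ?thesis using A(1) unfolding arrows_def by blast
qed

end
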